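(* Let $a,b>-1$ be real numbers and $N\ge1$. For any $\lambda\in\mathbb{GT}^+_N$, $$\Phi_\lambda(1+x_1,\dots,1+x_N|a,b)=\sum_{\mu\in\mathbb{GT}^+_N}\frac{t^*_{\mu|N}(\lambda)\,s_\mu(x_1,\dots,x_N)}{2^{|\mu|}\,c(N,\mu)},$$ where $s_\mu$ is the Schur polynomial parametrized by $\mu$ and $$c(N,\mu)=\prod_{i=1}^N(N-i+1)_{\mu_i}(N+a-i+1)_{\mu_i}.$$ (The sum on the right has only finitely many nonzero terms.)
   Context: $\mathbb{GT}^+_N$ is the set of $\lambda=(\lambda_1\ge\dots\ge\lambda_N)$ of nonnegative integers; $|\mu|=\mu_1+\dots+\mu_N$. Put $\epsilon=\frac{a+b+1}2$, $l_i=\lambda_i+N-i$, $\widehat l_i=(l_i+\epsilon)^2$. Pochhammer symbol: $(x)_n=x(x+1)\cdots(x+n-1)$, $(x)_0=1$. For $k\ge0$ put $(x|\boldsymbol\epsilon)^k=\prod_{i=0}^{k-1}\bigl(x-(\epsilon+i)^2\bigr)$ (equal to $1$ for $k=0$), and $$t^*_{\mu|N}(\lambda)=\frac{\det_{1\le i,j\le N}[(\widehat l_i|\boldsymbol\epsilon)^{\mu_j+N-j}]}{\prod_{1\le i<j\le N}(\widehat l_i-\widehat l_j)},\qquad\lambda,\mu\in\mathbb{GT}^+_N.$$ Let $\mathfrak P_k(x|a,b)$, $k\ge0$, be the Jacobi polynomials: $\deg\mathfrak P_k=k$, orthogonal on $[-1,1]$ with weight $(1-x)^a(1+x)^b$.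 For $\lambda\in\mathbb{GT}^+_N$ put $\mathfrak P_\lambda(x_1,\dots,x_N|a,b)=\det_{1\le i,j\le N}[\mathfrak P_{\lambda_i+N-i}(x_j|a,b)]/\prod_{i<j}(x_i-x_j)$ (a symmetric polynomial) and $\Phi_\lambda(x_1,\dots,x_N|a,b)=\mathfrak P_\lambda(x_1,\dots,x_N|a,b)/\mathfrak P_\lambda(1,\dots,1|a,b)$ (the denominator is nonzero). *)

theory Defs
  imports
    "HOL-Analysis.Analysis"
    "HOL-Computational_Algebra.Polynomial"
    "Jordan_Normal_Form.Determinant"
begin

text \<open>
  Conventions: indices are 0-based, so an index \<open>i \<in> {1..N}\<close> of the usual notation becomes
  \<open>i < N\<close>, and \<open>N - i\<close> becomes \<open>N - Suc i\<close>. Points of N-dimensional real space are functions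
  \<open>nat \<Rightarrow> real\<close> of which only the values below \<open>N\<close> matter.
\<close>

definition GTplus :: "nat \<Rightarrow> nat list set" where
  "GTplus N = {\<Lambda>. length \<Lambda> = N \<and> sorted_wrt (\<ge>) \<Lambda>}"

definition shifted :: "nat \<Rightarrow> nat list \<Rightarrow> nat \<Rightarrow> nat" where
  "shifted N \<Lambda> i = \<Lambda> ! i + (N - Suc i)"

definition vandermonde :: "nat \<Rightarrow> (nat \<Rightarrow> 'a::comm_ring_1) \<Rightarrow> 'a" where
  "vandermonde N x = (\<Prod>j<N. \<Prod>i<j. x i - x j)"

text \<open>
  Real polynomials in the variables \<open>x 0, \<dots>, x (N - 1)\<close>, viewed as functions, which loses nothing
  over the infinite field of real numbers; compare \<^const>\<open>real_polynomial_function\<close>, whose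
  domain has to be a normed vector space.
\<close>
inductive polynomial_in :: "nat \<Rightarrow> ((nat \<Rightarrow> real) \<Rightarrow> real) \<Rightarrow> bool" for N where
  var: "i < N \<Longrightarrow> polynomial_in N (\<lambda>x. x i)"
| const: "polynomial_in N (\<lambda>_. c)"
| add: "polynomial_in N f \<Longrightarrow> polynomial_in N g \<Longrightarrow> polynomial_in N (\<lambda>x. f x + g x)"
| mult: "polynomial_in N f \<Longrightarrow> polynomial_in N g \<Longrightarrow> polynomial_in N (\<lambda>x. f x * g x)"

text \<open>
  The polynomial \<open>det [p\<^sub>i(x\<^sub>j)] / vandermonde N x\<close>. The quotient is taken among polynomials, not
  pointwise, because it has to be evaluated where coordinates coincide, in particular at
  \<open>(1, \<dots>, 1)\<close>.
\<close>
definition alternant_quotient :: "nat \<Rightarrow> (nat \<Rightarrow> real poly) \<Rightarrow> (nat \<Rightarrow> real) \<Rightarrow> real" where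
  "alternant_quotient N p =
     (THE f. polynomial_in N f \<and>
        (\<forall>x. f x * vandermonde N x =
             Determinant.det (Matrix.mat N N (\<lambda>(i, j). poly (p i) (x j)))))"

definition schur :: "nat \<Rightarrow> nat list \<Rightarrow> (nat \<Rightarrow> real) \<Rightarrow> real" where
  "schur N \<mu> = alternant_quotient N (\<lambda>i. monom 1 (shifted N \<mu> i))"

text \<open>
  The Jacobi polynomials are specified only up to nonzero scalar factors, so every choice of
  normalization is allowed. The condition \<open>P k \<noteq> 0\<close> matters for \<open>k = 0\<close> only, as
  \<open>degree 0 = 0\<close>.
\<close>
definition jacobi_polynomials :: "real \<Rightarrow> real \<Rightarrow> (nat \<Rightarrow> real poly) \<Rightarrow> bool" where
  "jacobi_polynomials a b P \<longleftrightarrow>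
     (\<forall>k. P k \<noteq> 0 \<and> degree (P k) = k) \<and>
     (\<forall>j k. j \<noteq> k \<longrightarrow>
        integral {-1..1}
          (\<lambda>x. poly (P j) x * poly (P k) x * ((1 - x) powr a * (1 + x) powr b)) = 0)"

definition multi_jacobi ::
  "(nat \<Rightarrow> real poly) \<Rightarrow> nat \<Rightarrow> nat list \<Rightarrow> (nat \<Rightarrow> real) \<Rightarrow> real" where
  "multi_jacobi P N \<Lambda> = alternant_quotient N (\<lambda>i. P (shifted N \<Lambda> i))"

definition normalized_jacobi ::
  "(nat \<Rightarrow> real poly) \<Rightarrow> nat \<Rightarrow> nat list \<Rightarrow> (nat \<Rightarrow> real) \<Rightarrow> real" where
  "normalized_jacobi P N \<Lambda> x = multi_jacobi P N \<Lambda> x / multi_jacobi P N \<Lambda> (\<lambda>_. 1)"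

definition eps :: "real \<Rightarrow> real \<Rightarrow> real" where
  "eps a b = (a + b + 1) / 2"

definition lhat :: "real \<Rightarrow> real \<Rightarrow> nat \<Rightarrow> nat list \<Rightarrow> nat \<Rightarrow> real" where
  "lhat a b N \<Lambda> i = (real (shifted N \<Lambda> i) + eps a b)\<^sup>2"

definition factorial_power :: "real \<Rightarrow> real \<Rightarrow> real \<Rightarrow> nat \<Rightarrow> real" where
  "factorial_power a b x k = (\<Prod>i<k. x - (eps a b + real i)\<^sup>2)"

definition tstar :: "real \<Rightarrow> real \<Rightarrow> nat \<Rightarrow> nat list \<Rightarrow> nat list \<Rightarrow> real" where
  "tstar a b N \<mu> \<Lambda> =
     Determinant.det (Matrix.mat N N
       (\<lambda>(i, j). factorial_power a b (lhat a b N \<Lambda> i) (shifted N \<mu> j)))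
     / vandermonde N (lhat a b N \<Lambda>)"

definition cfactor :: "real \<Rightarrow> nat \<Rightarrow> nat list \<Rightarrow> real" where
  "cfactor a N \<mu> =
     (\<Prod>i<N. pochhammer (real (N - i)) (\<mu> ! i) * pochhammer (real (N - i) + a) (\<mu> ! i))"

end

(*
  The Jacobi differential operator is symmetric for the weight, so P k is an eigenvector of it; read
  in powers of x - 1, the eigenvalue equation is a two-term recursion, and the coefficient of
  (x - 1)^m in P k is P k (1) (l|eps)^m / (2^m m! (a+1)_m), where l = (k + eps)^2. Substituting this
  into the alternant of the P (l_i) and applying the Cauchy-Binet formula expands it in the
  alternants of monomials, with coefficients the numerators of t* up to explicit factors. Its value
  at (1, ..., 1) is the coefficient belonging to the empty partition.
*)
theory Submission
  imports Defs
begin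

section \<open>Polynomial quotients of alternants\<close>

text \<open>The obstacle is that \<open>alternant_quotient\<close> is a definite description of a
  polynomial, to be evaluated at (1, ..., 1), where the Vandermonde product vanishes once N > 1.
  Existence therefore comes from a formula that never divides by it: with divided differences built
  by synthetic division, the alternant matrix factors into \<open>newton_matrix\<close> times a
  triangular matrix of determinant \<open>vandermonde N x\<close>. At coinciding nodes divided
  differences become Taylor coefficients, so the value there is a determinant of coefficients. The
  shift eps completes a square: k (k + a + b + 1) - m (m + a + b + 1) = (k + eps)^2 - (m + eps)^2.
  Up to the factor P k (1), the Taylor coefficients of P k thus depend on k only through a monic
  polynomial of degree m in (k + eps)^2. For the empty partition their determinant is the
  Vandermonde product in \<open>lhat\<close>, exactly the denominator of \<open>tstar\<close>; it
  cancels on normalizing, as do the factors P k (1). The denominators 2^m m! (a+1)_m survive only as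
  a ratio between shifted partition and staircase, which is 2^|mu| c(N, mu).\<close>

lemma continuous_zero_off_finite:
  fixes f :: "real \<Rightarrow> real"
  assumes "continuous_on UNIV f" "finite T" "\<And>t. t \<notin> T \<Longrightarrow> f t = 0"
  shows "f t = 0"
proof -
  have "(f \<longlongrightarrow> f t) (at t)"
    using assms(1) by (simp add: continuous_on_def)
  moreover have "\<forall>\<^sub>F s in at t. s \<notin> T"
    using islimpt_finite[OF assms(2), of t] by (simp add: islimpt_iff_eventually)
  then have "\<forall>\<^sub>F s in at t. f s = 0"
    by eventually_elim (rule assms(3))
  then have "(f \<longlongrightarrow> 0) (at t)"
    by (rule tendsto_eventually)
  ultimately show ?thesis
    using tendsto_unique trivial_limit_at by blast
qed

lemma polynomial_in_sum: "(\<And>i. i \<in> A \<Longrightarrow> polynomial_in N (f i)) \<Longrightarrow> polynomial_in N (\<lambda>x. \<Sum>i\<in>A. f i x)"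
  by (induction A rule: infinite_finite_induct) (auto intro: polynomial_in.intros)

lemma polynomial_in_prod: "(\<And>i. i \<in> A \<Longrightarrow> polynomial_in N (f i)) \<Longrightarrow> polynomial_in N (\<lambda>x. \<Prod>i\<in>A. f i x)"
  by (induction A rule: infinite_finite_induct) (auto intro: polynomial_in.intros)

lemma polynomial_in_power: "polynomial_in N f \<Longrightarrow> polynomial_in N (\<lambda>x. f x ^ k)"
  by (induction k) (auto intro: polynomial_in.intros)

lemma polynomial_in_det:
  assumes "\<And>i j. i < n \<Longrightarrow> j < n \<Longrightarrow> polynomial_in N (f i j)"
  shows "polynomial_in N (\<lambda>x. Determinant.det (Matrix.mat n n (\<lambda>(i, j). f i j x)))"
proof -
  have "Determinant.det (Matrix.mat n n (\<lambda>(i, j). f i j x)) =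
      (\<Sum>p | p permutes {0..<n}. signof p * (\<Prod>i=0..<n. f i (p i) x))" for x
    by (subst Determinant.det_def) (auto intro!: sum.cong prod.cong arg_cong2[where f = "(*)"])
  then show ?thesis
    using assms by (auto intro!: polynomial_in_sum polynomial_in_prod polynomial_in.mult
        polynomial_in.const)
qed

lemma polynomial_in_shift: "polynomial_in N f \<Longrightarrow> polynomial_in N (\<lambda>x. f (\<lambda>i. c + x i))"
  by (induction rule: polynomial_in.induct) (auto intro: polynomial_in.intros)

lemma polynomial_in_continuous_on_line:
  "polynomial_in N f \<Longrightarrow> continuous_on UNIV (\<lambda>t. f (\<lambda>i. x i + t * y i))"
  by (induction rule: polynomial_in.induct) (auto intro!: continuous_intros)

lemma vandermonde_eq_0_iff:
  fixes x :: "nat \<Rightarrow> 'a::idom"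
  shows "vandermonde N x = 0 \<longleftrightarrow> (\<exists>j<N. \<exists>i<j. x i = x j)"
  by (auto simp: vandermonde_def)

text \<open>Cancellation of the Vandermonde factor, valid also where coordinates coincide: the
  uniqueness half of the definite description. The direction (0, 1, 2, ...) has pairwise distinct
  entries, so each pair of coordinates meets at most once along the line, and continuity fills in
  the exceptional points.\<close>

lemma polynomial_in_eqI:
  assumes "polynomial_in N f" "polynomial_in N g"
    and "\<And>x. f x * vandermonde N x = g x * vandermonde N x"
  shows "f = g"
proof
  fix x :: "nat \<Rightarrow> real"
  \<comment> \<open>On this line the \<open>vandermonde\<close> factor vanishes for finitely many \<open>t\<close> only.\<close>
  define d where "d t = f (\<lambda>i. x i + t * real i) - g (\<lambda>i. x i + t * real i)" for t
  define T where "T = (\<lambda>(i, j). (x i - x j) / (real j - real i)) ` ({..<N} \<times> {..<N})"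
  have "d t = 0" if "t \<notin> T" for t
  proof -
    have "vandermonde N (\<lambda>i. x i + t * real i) \<noteq> 0"
    proof
      assume "vandermonde N (\<lambda>i. x i + t * real i) = 0"
      then obtain i j where ij: "j < N" "i < j" "x i + t * real i = x j + t * real j"
        by (auto simp: vandermonde_eq_0_iff)
      then have "t = (x i - x j) / (real j - real i)"
        by (simp add: field_simps)
      with ij have "t \<in> T"
        by (auto simp: T_def image_iff intro!: bexI[of _ "(i, j)"])
      with that show False ..
    qed
    then show ?thesis
      using assms(3)[of "\<lambda>i. x i + t * real i"] by (simp add: d_def)
  qed
  moreover have "continuous_on UNIV d"
    unfolding d_def
    by (intro continuous_intros polynomial_in_continuous_on_line[OF assms(1)]
          polynomial_in_continuous_on_line[OF assms(2)])
  moreover have "finite T"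
    by (simp add: T_def)
  ultimately have "d 0 = 0"
    by (rule continuous_zero_off_finite[rotated 2])
  then show "f x = g x"
    by (simp add: d_def)
qed

section \<open>Divided differences and the Newton expansion\<close>

text \<open>As a polynomial in t this is the divided difference of \<open>p\<close> at
  \<open>y 0\<close>, ..., \<open>y (k - 1)\<close>, t. Synthetic division keeps it meaningful when
  nodes coincide.\<close>

primrec newton_quotient :: "'a::comm_ring_1 poly \<Rightarrow> (nat \<Rightarrow> 'a) \<Rightarrow> nat \<Rightarrow> 'a poly" where
  "newton_quotient p y 0 = p"
| "newton_quotient p y (Suc k) = synthetic_div (newton_quotient p y k) (y k)"

text \<open>Newton's interpolation formula with remainder: each step divides the remainder's
  polynomial factor by t - \<open>y K\<close>.\<close>

lemma newton_expansion:
  "poly p t = (\<Sum>k<K. poly (newton_quotient p y k) (y k) * (\<Prod>m<k. t - y m))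
     + poly (newton_quotient p y K) t * (\<Prod>m<K. t - y m)"
proof (induction K)
  case (Suc K)
  let ?q = "newton_quotient p y K"
  have "poly ?q t = poly ([:- y K, 1:] * synthetic_div ?q (y K) + [:poly ?q (y K):]) t"
    by (simp only: synthetic_div_correct')
  then have "poly ?q t = (t - y K) * poly (synthetic_div ?q (y K)) t + poly ?q (y K)"
    by (simp add: algebra_simps)
  with Suc show ?case
    by (simp add: algebra_simps)
qed simp

lemma degree_newton_quotient: "degree (newton_quotient p y k) = degree p - k"
  by (induction k) (simp_all add: degree_synthetic_div)

text \<open>Horner's rule, which computes the quotient's coefficients from the top degree
  downwards.\<close>

lemma coeff_synthetic_div:
  "coeff (synthetic_div p c) n = coeff p (Suc n) + c * coeff (synthetic_div p c) (Suc n)"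
  using arg_cong[OF synthetic_div_correct[of p c], of "\<lambda>q. coeff q (Suc n)"] by simp

text \<open>Dividing by monic linear factors leaves the leading coefficient alone, so the nodes do
  not enter at this degree or above.\<close>

lemma coeff_newton_quotient_top:
  "degree p \<le> n + k \<Longrightarrow> coeff (newton_quotient p y k) n = coeff p (n + k)"
proof (induction k arbitrary: n)
  case (Suc k)
  have "coeff (newton_quotient p y (Suc k)) (Suc n) = 0"
    using Suc.prems by (intro coeff_eq_0) (simp only: degree_newton_quotient)
  then show ?case
    using Suc by (simp add: coeff_synthetic_div[of _ _ n])
qed simp

text \<open>Outer induction on the number of nodes; inner induction downwards in \<open>n\<close>
  along Horner's rule, starting at \<open>degree p\<close>, where the coefficient is a
  constant.\<close>

lemma polynomial_in_coeff_newton_quotient: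
  assumes "k \<le> N"
  shows "polynomial_in N (\<lambda>x. coeff (newton_quotient p (\<lambda>m. x (N - Suc m)) k) n)"
  using assms
proof (induction k arbitrary: n)
  case 0
  then show ?case
    by (simp add: polynomial_in.const)
next
  case (Suc k)
  let ?q = "\<lambda>x. newton_quotient p (\<lambda>m. x (N - Suc m))"
  show ?case
  proof (induction "degree p - n" arbitrary: n)
    case 0
    then have "coeff (?q x (Suc k)) n = coeff p (n + Suc k)" for x
      by (intro coeff_newton_quotient_top) simp
    then show ?case
      by (simp only: polynomial_in.const)
  next
    case (Suc d)
    have "polynomial_in N (\<lambda>x. coeff (?q x k) (Suc n) + x (N - Suc k) * coeff (?q x (Suc k)) (Suc n))"
      using Suc.prems Suc.IH \<open>Suc k \<le> N\<close> Suc.hyps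
      by (intro polynomial_in.intros) auto
    then show ?case
      by (simp add: coeff_synthetic_div[of _ _ n])
  qed
qed

lemma polynomial_in_poly_newton_quotient:
  assumes "k \<le> N" "j < N"
  shows "polynomial_in N (\<lambda>x. poly (newton_quotient p (\<lambda>m. x (N - Suc m)) k) (x j))"
  unfolding poly_altdef degree_newton_quotient
  by (intro polynomial_in_sum polynomial_in.mult polynomial_in_coeff_newton_quotient assms
        polynomial_in_power polynomial_in.var)

text \<open>
  The columns are numbered in reverse, the node \<open>x (N - 1)\<close> being divided out first: this makes
  the complementary factor lower triangular with determinant exactly \<open>vandermonde N x\<close>, no sign.
\<close>
definition newton_matrix :: "nat \<Rightarrow> (nat \<Rightarrow> real poly) \<Rightarrow> (nat \<Rightarrow> real) \<Rightarrow> real mat" where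
  "newton_matrix N p x =
     Matrix.mat N N (\<lambda>(i, k). poly (newton_quotient (p i) (\<lambda>m. x (N - Suc m)) (N - Suc k)) (x k))"

lemma newton_matrix_dim [simp]:
  "dim_row (newton_matrix N p x) = N" "dim_col (newton_matrix N p x) = N"
  by (simp_all add: newton_matrix_def)

text \<open>The Newton expansion of every \<open>p i\<close> at the nodes \<open>x (N - 1)\<close>,
  ..., \<open>x 0\<close>, written as a matrix product; the Newton basis evaluated at the nodes is
  triangular.\<close>

lemma alternant_eq_newton_matrix:
  "Determinant.det (Matrix.mat N N (\<lambda>(i, j). poly (p i) (x j)))
     = Determinant.det (newton_matrix N p x) * vandermonde N x"
proof -
  define y where "y m = x (N - Suc m)" for m
  define U where "U = Matrix.mat N N (\<lambda>(k, j). \<Prod>m<N - Suc k. x j - y m)"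
  have U0: "(\<Prod>m<N - Suc k. x j - y m) = 0" if "k < j" "j < N" for k j
    using that by (intro prod_zero) (auto intro!: bexI[of _ "N - Suc j"] simp: y_def)
  have "Matrix.mat N N (\<lambda>(i, j). poly (p i) (x j)) = newton_matrix N p x * U"
  proof (rule eq_matI)
    fix i j
    assume "i < dim_row (newton_matrix N p x * U)" "j < dim_col (newton_matrix N p x * U)"
    then have ij: "i < N" "j < N"
      by (simp_all add: newton_matrix_def U_def)
    \<comment> \<open>All N coordinates occur among the nodes, so the remainder of the Newton
      expansion vanishes at \<open>x j\<close>.\<close>
    have last: "(\<Prod>m<N. x j - y m) = 0"
      using ij by (intro prod_zero) (auto intro!: bexI[of _ "N - Suc j"] simp: y_def)
    have "poly (p i) (x j)
        = (\<Sum>k<N. poly (newton_quotient (p i) y k) (y k) * (\<Prod>m<k. x j - y m))"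
      using newton_expansion[of "p i" "x j" y N] by (simp add: last)
    also have "\<dots> = (\<Sum>k<N. poly (newton_quotient (p i) y (N - Suc k)) (y (N - Suc k))
        * (\<Prod>m<N - Suc k. x j - y m))"
      by (rule sum.nat_diff_reindex[symmetric])
    also have "\<dots> = (\<Sum>k<N. poly (newton_quotient (p i) y (N - Suc k)) (x k)
        * (\<Prod>m<N - Suc k. x j - y m))"
      by (intro sum.cong) (auto simp: y_def Suc_diff_Suc)
    finally show "Matrix.mat N N (\<lambda>(i, j). poly (p i) (x j)) $$ (i, j) = (newton_matrix N p x * U) $$ (i, j)"
      using ij by (simp add: newton_matrix_def U_def y_def[abs_def] scalar_prod_def atLeast0LessThan)
  qed (auto simp: newton_matrix_def U_def)
  moreover have "Determinant.det U = (\<Prod>j<N. \<Prod>m<N - Suc j. x j - y m)"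
    by (subst det_lower_triangular[of N])
       (auto simp: U_def U0 prod_list_diag_prod atLeast0LessThan intro!: prod.cong)
  moreover have "(\<Prod>j<N. \<Prod>m<N - Suc j. x j - y m) = vandermonde N x"
    unfolding vandermonde_def y_def
    by (simp add: prod.Sigma, rule prod.reindex_bij_witness
          [where i = "\<lambda>(j, i). (i, N - Suc j)" and j = "\<lambda>(j, m). (N - Suc m, j)"]) auto
  ultimately show ?thesis
    by (simp add: det_mult[of _ N] newton_matrix_def U_def)
qed

lemma polynomial_in_det_newton_matrix: "polynomial_in N (\<lambda>x. Determinant.det (newton_matrix N p x))"
  unfolding newton_matrix_def
  by (intro polynomial_in_det polynomial_in_poly_newton_quotient) auto

lemma alternant_quotient_eqI:
  assumes "polynomial_in N f"
    and "\<And>x. f x * vandermonde N x = Determinant.det (Matrix.mat N N (\<lambda>(i, j). poly (p i) (x j)))"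
  shows "alternant_quotient N p = f"
  unfolding alternant_quotient_def
  by (rule the_equality) (use assms in \<open>auto intro: polynomial_in_eqI\<close>)

text \<open>This replaces the definite description by a formula that can be evaluated at coinciding
  coordinates.\<close>

lemma alternant_quotient_eq: "alternant_quotient N p = (\<lambda>x. Determinant.det (newton_matrix N p x))"
  by (rule alternant_quotient_eqI)
     (simp_all add: polynomial_in_det_newton_matrix alternant_eq_newton_matrix)

lemma polynomial_in_alternant_quotient: "polynomial_in N (alternant_quotient N p)"
  by (simp add: alternant_quotient_eq polynomial_in_det_newton_matrix)

lemma alternant_quotient_times_vandermonde:
  "alternant_quotient N p x * vandermonde N x
     = Determinant.det (Matrix.mat N N (\<lambda>(i, j). poly (p i) (x j)))"
  by (simp add: alternant_quotient_eq alternant_eq_newton_matrix)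

section \<open>Translations and special values of alternant quotients\<close>

text \<open>Differences of coordinates are translation invariant, so the Vandermonde product is
  unchanged and the shift passes to the one-variable polynomials.\<close>

lemma alternant_quotient_shift:
  "alternant_quotient N p (\<lambda>i. c + x i) = alternant_quotient N (\<lambda>i. pcompose (p i) [:c, 1:]) x"
proof -
  have "vandermonde N (\<lambda>i. c + x i) = vandermonde N x" for x :: "nat \<Rightarrow> real"
    by (simp add: vandermonde_def)
  then have "alternant_quotient N p (\<lambda>i. c + x i) * vandermonde N x
      = Determinant.det (Matrix.mat N N (\<lambda>(i, j). poly (pcompose (p i) [:c, 1:]) (x j)))"
    for x :: "nat \<Rightarrow> real"
    using alternant_quotient_times_vandermonde[of N p "\<lambda>i. c + x i"]
    by (simp add: poly_pcompose)
  then have "alternant_quotient N (\<lambda>i. pcompose (p i) [:c, 1:]) = (\<lambda>x. alternant_quotient N p (\<lambda>i. c + x i))"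
    by (rule alternant_quotient_eqI[OF polynomial_in_shift[OF polynomial_in_alternant_quotient]])
  then show ?thesis
    by simp
qed

text \<open>A divided difference of order at least the degree is constant: the leading coefficient
  when the two agree, zero beyond. Hence \<open>newton_matrix\<close> is upper triangular with unit
  diagonal.\<close>

lemma alternant_monic_eq_vandermonde:
  fixes p :: "nat \<Rightarrow> real poly"
  assumes "\<And>i. i < N \<Longrightarrow> degree (p i) = N - Suc i" "\<And>i. i < N \<Longrightarrow> lead_coeff (p i) = 1"
  shows "Determinant.det (Matrix.mat N N (\<lambda>(i, j). poly (p i) (x j))) = vandermonde N x"
proof -
  let ?y = "\<lambda>m. x (N - Suc m)"
  have entry: "newton_matrix N p x $$ (i, k) = (if i = k then 1 else 0)" if "k \<le> i" "i < N" for i k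
  proof -
    have "coeff (newton_quotient (p i) ?y (N - Suc k)) n = coeff [:coeff (p i) (N - Suc k):] n" for n
      using that assms(1)[of i]
      by (subst coeff_newton_quotient_top) (auto simp: coeff_pCons coeff_eq_0 split: nat.splits)
    then have "newton_quotient (p i) ?y (N - Suc k) = [:coeff (p i) (N - Suc k):]"
      by (rule poly_eqI)
    then show ?thesis
      using that assms[of i] by (auto simp: newton_matrix_def intro: coeff_eq_0)
  qed
  have "Determinant.det (newton_matrix N p x) = prod_list (diag_mat (newton_matrix N p x))"
    by (rule det_upper_triangular[of _ N])
       (auto simp: upper_triangular_def entry)
  also have "\<dots> = 1"
    by (simp add: prod_list_diag_prod entry)
  finally show ?thesis
    by (simp add: alternant_eq_newton_matrix)
qed

text \<open>With all nodes at 0, synthetic division just drops the constant coefficient, so divided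
  differences turn into coefficients. After a shift by 1 this gives the normalizing value at (1,
  ..., 1).\<close>

lemma alternant_quotient_at_0:
  "alternant_quotient N p (\<lambda>_. 0) = Determinant.det (Matrix.mat N N (\<lambda>(i, k). coeff (p i) (N - Suc k)))"
proof -
  have "coeff (synthetic_div q 0) n = coeff q (Suc n)" for q :: "real poly" and n
    by (subst coeff_synthetic_div) simp
  then have "coeff (newton_quotient q (\<lambda>_. 0) k) n = coeff q (n + k)" for q :: "real poly" and k n
    by (induction k arbitrary: n) simp_all
  then show ?thesis
    by (simp add: alternant_quotient_eq newton_matrix_def poly_0_coeff_0)
qed

lemma det_scale_rows_columns:
  fixes c d :: "nat \<Rightarrow> 'a::comm_ring_1"
  shows "Determinant.det (Matrix.mat N N (\<lambda>(i, j). c i * f i j * d j))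
     = (\<Prod>i<N. c i) * (\<Prod>j<N. d j) * Determinant.det (Matrix.mat N N (\<lambda>(i, j). f i j))"
proof -
  have det: "Determinant.det (Matrix.mat N N (\<lambda>(i, j). g i j)) =
      (\<Sum>p | p permutes {0..<N}. signof p * (\<Prod>i<N. g i (p i)))" for g :: "nat \<Rightarrow> nat \<Rightarrow> 'a"
    by (subst Determinant.det_def)
       (auto simp: atLeast0LessThan intro!: sum.cong prod.cong arg_cong2[where f = "(*)"])
  have "(\<Prod>i<N. d (p i)) = (\<Prod>j<N. d j)" if "p permutes {0..<N}" for p
    using prod.permute[OF that, of d] by (simp add: atLeast0LessThan o_def)
  then show ?thesis
    unfolding det sum_distrib_left
    by (intro sum.cong) (auto simp: prod.distrib ac_simps)
qed

section \<open>The Cauchy--Binet formula\<close>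

lemma shifted_strict_antimono:
  assumes "\<mu> \<in> GTplus N" "i < j" "j < N"
  shows "shifted N \<mu> j < shifted N \<mu> i"
proof -
  have "\<mu> ! j \<le> \<mu> ! i"
    using assms sorted_wrt_nth_less[of "(\<ge>)" \<mu> i j] by (simp add: GTplus_def)
  then show ?thesis
    using assms by (simp add: shifted_def)
qed

lemma inj_on_shifted: "\<mu> \<in> GTplus N \<Longrightarrow> inj_on (shifted N \<mu>) {0..<N}"
  by (intro linorder_inj_onI) (auto dest: shifted_strict_antimono)

lemma strictly_decreasing_gap:
  fixes f :: "nat \<Rightarrow> nat"
  assumes "\<And>i j. i < j \<Longrightarrow> j < N \<Longrightarrow> f j < f i" "i \<le> j" "j < N"
  shows "f j + (j - i) \<le> f i"
  using assms(2,3)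
proof (induction j rule: dec_induct)
  case (step j)
  then show ?case
    using assms(1)[of j "Suc j"] by auto
qed simp

lemma GTplus_eq_shifted:
  assumes decr: "\<And>i j. i < j \<Longrightarrow> j < N \<Longrightarrow> f j < f i"
  obtains \<mu> where "\<mu> \<in> GTplus N" "\<And>i. i < N \<Longrightarrow> shifted N \<mu> i = f i"
proof
  let ?\<mu> = "map (\<lambda>i. f i - (N - Suc i)) [0..<N]"
  have "f j - (N - Suc j) \<le> f i - (N - Suc i)" if "i < j" "j < N" for i j
    using strictly_decreasing_gap[of N f i j] decr that by fastforce
  then show "?\<mu> \<in> GTplus N"
    by (auto simp: GTplus_def sorted_wrt_iff_nth_less)
  show "shifted N ?\<mu> i = f i" if "i < N" for i
  proof -
    \<comment> \<open>The gap down to the last entry makes the truncated subtraction of the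
      staircase exact.\<close>
    have "N - Suc i \<le> f i"
      using strictly_decreasing_gap[of N f i "N - 1"] decr that by fastforce
    then show ?thesis
      using that by (simp add: shifted_def)
  qed
qed

text \<open>A finite set has only one decreasing enumeration. Partitions thus encode the N-element
  sets of exponents. The lists are reversed to use uniqueness of strictly increasing lists.\<close>

lemma GTplus_shifted_inject:
  assumes "\<mu> \<in> GTplus N" "\<nu> \<in> GTplus N"
    and "shifted N \<mu> ` {0..<N} = shifted N \<nu> ` {0..<N}"
  shows "\<mu> = \<nu>"
proof -
  have sorted: "sorted_wrt (>) (map (shifted N \<kappa>) [0..<N])" if "\<kappa> \<in> GTplus N" for \<kappa>
    using that by (auto simp: sorted_wrt_iff_nth_less intro: shifted_strict_antimono)
  have "rev (map (shifted N \<mu>) [0..<N]) = rev (map (shifted N \<nu>) [0..<N])"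
    by (rule strict_sorted_equal)
       (use sorted assms in \<open>simp_all add: sorted_wrt_rev del: rev_map rev_is_rev_conv\<close>)
  then have "map (shifted N \<mu>) [0..<N] = map (shifted N \<nu>) [0..<N]"
    by (simp only: rev_is_rev_conv)
  then have "shifted N \<mu> i = shifted N \<nu> i" if "i < N" for i
    using that by simp
  then have "\<mu> ! i = \<nu> ! i" if "i < N" for i
    using that unfolding shifted_def by (meson add_right_imp_eq)
  then show "\<mu> = \<nu>"
    using assms(1,2) by (intro nth_equalityI) (auto simp: GTplus_def)
qed

text \<open>An injective choice of N elements of \<open>S\<close> is its image, listed decreasingly
  as a shifted partition, together with the order in which the elements are chosen.\<close>

lemma bij_betw_shifted_permutations:
  fixes N :: nat and S :: "nat set"
  defines "G \<equiv> {\<mu> \<in> GTplus N. \<forall>i<N. shifted N \<mu> i \<in> S}"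
  shows "bij_betw (\<lambda>(\<mu>, \<pi>). restrict (shifted N \<mu> \<circ> \<pi>) {0..<N})
    (G \<times> {\<pi>. \<pi> permutes {0..<N}}) {f \<in> {0..<N} \<rightarrow>\<^sub>E S. inj_on f {0..<N}}"
proof (rule bij_betw_imageI)
  show "inj_on (\<lambda>(\<mu>, \<pi>). restrict (shifted N \<mu> \<circ> \<pi>) {0..<N}) (G \<times> {\<pi>. \<pi> permutes {0..<N}})"
  proof (rule inj_onI, clarsimp)
    fix \<mu> \<pi> \<nu> \<rho>
    assume G: "\<mu> \<in> G" "\<nu> \<in> G" and perm: "\<pi> permutes {0..<N}" "\<rho> permutes {0..<N}"
      and eq: "restrict (shifted N \<mu> \<circ> \<pi>) {0..<N} = restrict (shifted N \<nu> \<circ> \<rho>) {0..<N}"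
    have pt: "shifted N \<mu> (\<pi> i) = shifted N \<nu> (\<rho> i)" if "i < N" for i
      using fun_cong[OF eq, of i] that by simp
    have "(shifted N \<mu> \<circ> \<pi>) ` {0..<N} = (shifted N \<nu> \<circ> \<rho>) ` {0..<N}"
      by (rule image_cong) (auto simp: pt)
    then have "shifted N \<mu> ` {0..<N} = shifted N \<nu> ` {0..<N}"
      unfolding image_comp[symmetric] permutes_image[OF perm(1)] permutes_image[OF perm(2)] .
    then have "\<mu> = \<nu>"
      using G by (intro GTplus_shifted_inject) (auto simp: G_def)
    moreover have "\<pi> i = \<rho> i" for i
    proof (cases "i < N")
      case True
      then have "\<pi> i \<in> {0..<N}" "\<rho> i \<in> {0..<N}"
        using perm by (simp_all only: permutes_in_image) simp_all
      then show ?thesis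
        using pt[OF True] \<open>\<mu> = \<nu>\<close> inj_on_shifted[of \<nu> N] G by (auto simp: G_def dest: inj_onD)
    next
      case False
      then show ?thesis
        using perm by (auto simp: permutes_def)
    qed
    ultimately show "\<mu> = \<nu> \<and> \<pi> = \<rho>"
      by auto
  qed
next
  show "(\<lambda>(\<mu>, \<pi>). restrict (shifted N \<mu> \<circ> \<pi>) {0..<N}) ` (G \<times> {\<pi>. \<pi> permutes {0..<N}})
      = {f \<in> {0..<N} \<rightarrow>\<^sub>E S. inj_on f {0..<N}}" (is "?l = ?r")
  proof (intro equalityI subsetI)
    fix f
    assume "f \<in> ?l"
    then obtain \<mu> \<pi> where f: "f = restrict (shifted N \<mu> \<circ> \<pi>) {0..<N}"
      and \<mu>: "\<mu> \<in> G" and \<pi>: "\<pi> permutes {0..<N}"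
      by auto
    have "inj_on (shifted N \<mu> \<circ> \<pi>) {0..<N}"
      using \<mu> \<pi> by (intro comp_inj_on) (auto simp: G_def permutes_image intro: inj_on_shifted permutes_inj_on)
    moreover have "\<pi> i < N" if "i < N" for i
      using permutes_in_image[OF \<pi>, of i] that by simp
    ultimately show "f \<in> ?r"
      using \<mu> by (auto simp: f G_def)
  next
    fix f
    assume f: "f \<in> ?r"
    define l where "l = rev (sorted_list_of_set (f ` {0..<N}))"
    have card: "card (f ` {0..<N}) = N"
      using f by (simp add: card_image)
    then have len: "length l = N"
      by (simp add: l_def)
    have "sorted_wrt (>) l"
      by (simp add: l_def sorted_wrt_rev)
    then have decr: "l ! j < l ! i" if "i < j" "j < N" for i j
      using that len by (simp add: sorted_wrt_iff_nth_less)
    obtain \<mu> where \<mu>: "\<mu> \<in> GTplus N" "\<And>i. i < N \<Longrightarrow> shifted N \<mu> i = l ! i"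
      using GTplus_eq_shifted[of N "(!) l"] decr by blast
    have bij: "bij_betw (shifted N \<mu>) {0..<N} (f ` {0..<N})"
    proof (rule bij_betw_imageI)
      have "shifted N \<mu> ` {0..<N} = (!) l ` {0..<N}"
        using \<mu>(2) by (intro image_cong) auto
      also have "\<dots> = set l"
        using nth_image[of N l] len by simp
      finally show "shifted N \<mu> ` {0..<N} = f ` {0..<N}"
        by (simp add: l_def)
    qed (rule inj_on_shifted[OF \<mu>(1)])
    \<comment> \<open>The identity outside the range is what \<open>permutes\<close>
      demands.\<close>
    define \<pi> where "\<pi> i = (if i < N then inv_into {0..<N} (shifted N \<mu>) (f i) else i)" for i
    have "bij_betw (inv_into {0..<N} (shifted N \<mu>) \<circ> f) {0..<N} {0..<N}"
      using f bij by (intro bij_betw_trans[of f _ "f ` {0..<N}"] bij_betw_inv_into) (auto simp: bij_betw_def)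
    then have "bij_betw \<pi> {0..<N} {0..<N}"
      by (rule bij_betw_cong[THEN iffD1, rotated]) (simp add: \<pi>_def)
    then have perm: "\<pi> permutes {0..<N}"
      by (rule bij_imp_permutes) (simp add: \<pi>_def)
    have "shifted N \<mu> (\<pi> i) = f i" if "i < N" for i
      using that bij by (simp add: \<pi>_def bij_betw_inv_into_right)
    then have "f = restrict (shifted N \<mu> \<circ> \<pi>) {0..<N}"
      using f by (intro ext) (simp add: restrict_def PiE_def extensional_def)
    moreover have "shifted N \<mu> i \<in> S" if "i < N" for i
    proof -
      have "f ` {0..<N} \<subseteq> S"
        using f by (auto simp: PiE_def)
      then show ?thesis
        using bij_betw_apply[OF bij, of i] that by auto
    qed
    ultimately show "f \<in> ?l"
      using \<mu>(1) perm by (auto simp: G_def image_iff)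
  qed
qed

text \<open>Column subsets are indexed by partitions, so the minors appear directly in the form used
  by \<open>schur\<close> and \<open>tstar\<close>. Multiplying out gives a sum over all maps f into
  \<open>S\<close>; non-injective ones yield a repeated row of \<open>B\<close>, and for the others
  the sign from reordering rows of \<open>B\<close> assembles the minor of \<open>A\<close>.\<close>

theorem cauchy_binet_GTplus:
  fixes A B :: "nat \<Rightarrow> nat \<Rightarrow> 'a::comm_ring_1" and N :: nat and S :: "nat set"
  assumes S: "finite S"
  defines "G \<equiv> {\<mu> \<in> GTplus N. \<forall>i<N. shifted N \<mu> i \<in> S}"
  shows "Determinant.det (Matrix.mat N N (\<lambda>(i, j). \<Sum>m\<in>S. A i m * B m j)) =
    (\<Sum>\<mu>\<in>G. Determinant.det (Matrix.mat N N (\<lambda>(i, k). A i (shifted N \<mu> k)))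
          * Determinant.det (Matrix.mat N N (\<lambda>(k, j). B (shifted N \<mu> k) j)))"
proof -
  have det: "Determinant.det (Matrix.mat N N (\<lambda>(i, j). g i j)) =
      (\<Sum>p | p permutes {0..<N}. signof p * (\<Prod>i=0..<N. g i (p i)))" for g :: "nat \<Rightarrow> nat \<Rightarrow> 'a"
    by (subst Determinant.det_def) (auto intro!: sum.cong prod.cong arg_cong2[where f = "(*)"])
  define D where "D f = Determinant.det (Matrix.mat N N (\<lambda>(i, j). B (f i) j))" for f
  define T where "T f = (\<Prod>i=0..<N. A i (f i)) * D f" for f
  have D_cong: "D f = D g" if "\<And>i. i < N \<Longrightarrow> f i = g i" for f g
    unfolding D_def using that by (intro arg_cong[where f = Determinant.det] cong_mat) auto
  have T_cong: "T f = T g" if "\<And>i. i < N \<Longrightarrow> f i = g i" for f g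
    unfolding T_def using that D_cong[of f g] by simp
  have D_perm: "D (f \<circ> \<pi>) = signof \<pi> * D f" if "\<pi> permutes {0..<N}" for f \<pi>
  proof -
    have "Matrix.mat N N (\<lambda>(i, j). B ((f \<circ> \<pi>) i) j)
        = Matrix.mat N N (\<lambda>(i, j). Matrix.mat N N (\<lambda>(i, j). B (f i) j) $$ (\<pi> i, j))"
      using permutes_in_image[OF that] by (intro cong_mat) auto
    then have "D (f \<circ> \<pi>) = Determinant.det (Matrix.mat N N
        (\<lambda>(i, j). Matrix.mat N N (\<lambda>(i, j). B (f i) j) $$ (\<pi> i, j)))"
      unfolding D_def by (simp only:)
    also have "\<dots> = signof \<pi> * D f"
      unfolding D_def by (rule det_permute_rows[OF _ that]) simp
    finally show ?thesis .
  qed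
  have D_not_inj: "D f = 0" if "\<not> inj_on f {0..<N}" for f
  proof -
    from that obtain i j where "i < N" "j < N" "i \<noteq> j" "f i = f j"
      by (auto simp: inj_on_def)
    then show ?thesis
      unfolding D_def by (intro det_identical_rows[of _ N i j]) auto
  qed
  have "Determinant.det (Matrix.mat N N (\<lambda>(i, j). \<Sum>m\<in>S. A i m * B m j))
      = (\<Sum>p | p permutes {0..<N}. signof p * (\<Sum>f\<in>{0..<N} \<rightarrow>\<^sub>E S. \<Prod>i=0..<N. A i (f i) * B (f i) (p i)))"
    unfolding det by (subst prod_sum_PiE) (auto simp: S)
  also have "\<dots> = (\<Sum>f\<in>{0..<N} \<rightarrow>\<^sub>E S. T f)"
    unfolding T_def D_def det sum_distrib_left
    by (subst sum.swap) (simp add: prod.distrib ac_simps)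
  also have "\<dots> = (\<Sum>f\<in>{f \<in> {0..<N} \<rightarrow>\<^sub>E S. inj_on f {0..<N}}. T f)"
    by (rule sum.mono_neutral_right) (auto simp: S T_def D_not_inj intro: finite_PiE)
  also have "\<dots> = (\<Sum>(\<mu>, \<pi>)\<in>G \<times> {\<pi>. \<pi> permutes {0..<N}}. T (restrict (shifted N \<mu> \<circ> \<pi>) {0..<N}))"
    unfolding G_def
    by (subst sum.reindex_bij_betw[OF bij_betw_shifted_permutations, symmetric])
       (simp add: case_prod_unfold)
  also have "\<dots> = (\<Sum>\<mu>\<in>G. \<Sum>\<pi> | \<pi> permutes {0..<N}. T (shifted N \<mu> \<circ> \<pi>))"
    by (subst sum.cartesian_product[symmetric]) (intro sum.cong refl T_cong, auto)
  also have "\<dots> = (\<Sum>\<mu>\<in>G. Determinant.det (Matrix.mat N N (\<lambda>(i, k). A i (shifted N \<mu> k))) * D (shifted N \<mu>))"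
    unfolding det[of "\<lambda>i k. A i (shifted N _ k)"] sum_distrib_right
    by (intro sum.cong refl) (simp add: T_def D_perm)
  finally show ?thesis
    unfolding D_def .
qed

section \<open>Taylor coefficients of Jacobi polynomials at 1\<close>

definition jacobi_weight :: "real \<Rightarrow> real \<Rightarrow> real \<Rightarrow> real" where
  "jacobi_weight a b x = (1 - x) powr a * (1 + x) powr b"

definition jacobi_integral :: "real \<Rightarrow> real \<Rightarrow> real poly \<Rightarrow> real" where
  "jacobi_integral a b p = integral {-1..1} (\<lambda>x. poly p x * jacobi_weight a b x)"

text \<open>With w the weight, this is ((1 - x^2) w p')' / w on the open interval, the
  Sturm-Liouville form behind its symmetry.\<close>

definition jacobi_operator :: "real \<Rightarrow> real \<Rightarrow> real poly \<Rightarrow> real poly" where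
  "jacobi_operator a b p =
     [:1, 0, -1:] * pderiv (pderiv p) + [:b - a, - (a + b + 2):] * pderiv p"

lemma jacobi_weight_nonneg: "jacobi_weight a b x \<ge> 0"
  by (simp add: jacobi_weight_def)

lemma jacobi_weight_integrable:
  assumes "a > -1" "b > -1"
  shows "jacobi_weight a b integrable_on {-1..1}"
proof -
  have "((\<lambda>t. t powr b * (1 - t) powr a) has_integral Beta (b + 1) (a + 1)) {0..1}"
    using has_integral_Beta_real[of "b + 1" "a + 1"] assms by simp
  then have "((\<lambda>t. t powr b * (1 - t) powr a) has_integral Beta (b + 1) (a + 1)) (cbox 0 1)"
    by (simp add: cbox_interval)
  \<comment> \<open>The substitution t = (1 + x) / 2 carries the Beta integral to [-1, 1]; the
    powers of 2 it creates are restored below.\<close>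
  from has_integral_affinity'[OF this, of "1/2" "1/2"]
  have "(\<lambda>x. (x / 2 + 1 / 2) powr b * (1 - (x / 2 + 1 / 2)) powr a) integrable_on {-1..1}"
    by (auto simp: integrable_on_def cbox_interval)
  then have "(\<lambda>x. 2 powr a * 2 powr b *
      ((x / 2 + 1 / 2) powr b * (1 - (x / 2 + 1 / 2)) powr a)) integrable_on {-1..1}"
    by (rule integrable_on_mult_right)
  then show ?thesis
  proof (rule integrable_eq)
    fix x :: real
    assume x: "x \<in> {-1..1}"
    have halves: "x / 2 + 1 / 2 = (1 + x) / 2" "1 - (1 + x) / 2 = (1 - x) / 2"
      by (simp_all add: field_simps)
    show "2 powr a * 2 powr b * ((x / 2 + 1 / 2) powr b * (1 - (x / 2 + 1 / 2)) powr a)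
        = jacobi_weight a b x"
      unfolding halves using x by (simp add: jacobi_weight_def powr_divide)
  qed
qed

text \<open>For negative exponents the weight is unbounded at the endpoints, so integrability comes
  from an absolutely integrable function times a bounded measurable one.\<close>

lemma poly_jacobi_weight_integrable:
  assumes "a > -1" "b > -1"
  shows "(\<lambda>x. poly p x * jacobi_weight a b x) integrable_on {-1..1}"
proof -
  have "jacobi_weight a b absolutely_integrable_on {-1..1}"
    by (rule nonnegative_absolutely_integrable_1)
       (simp_all add: jacobi_weight_integrable assms jacobi_weight_nonneg)
  moreover have "continuous_on {-1..1} (poly p)"
    by (intro continuous_intros)
  ultimately have "(\<lambda>x. poly p x * jacobi_weight a b x) absolutely_integrable_on {-1..1}"
    by (intro absolutely_integrable_bounded_measurable_product_real)
       (auto intro: continuous_imp_measurable_on_sets_lebesgue compact_imp_bounded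
          compact_continuous_image)
  then show ?thesis
    using set_lebesgue_integral_eq_integral(1) by blast
qed

section \<open>The weighted integral as an inner product\<close>

context
  fixes a b :: real
  assumes a: "a > -1" and b: "b > -1"
begin

lemma jacobi_integral_add:
  "jacobi_integral a b (p + q) = jacobi_integral a b p + jacobi_integral a b q"
  unfolding jacobi_integral_def poly_add distrib_right
  by (intro integral_add poly_jacobi_weight_integrable a b)

lemma jacobi_integral_smult:
  "jacobi_integral a b (Polynomial.smult c p) = c * jacobi_integral a b p"
  by (simp add: jacobi_integral_def mult.assoc)

lemma jacobi_integral_diff:
  "jacobi_integral a b (p - q) = jacobi_integral a b p - jacobi_integral a b q"
  using jacobi_integral_add[of p "Polynomial.smult (-1) q"] jacobi_integral_smult[of "-1" q] by simp

text \<open>The integrand is the derivative of (1 - x)^(a+1) (1 + x)^(b+1) f(x), whose boundary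
  values vanish because both exponents are positive.\<close>

lemma jacobi_integral_total_derivative:
  "jacobi_integral a b ([:1, 0, -1:] * pderiv f + [:b - a, - (a + b + 2):] * f) = 0"
proof -
  let ?F = "\<lambda>x. (1 - x) powr (a + 1) * (1 + x) powr (b + 1) * poly f x"
  let ?g = "[:1, 0, -1:] * pderiv f + [:b - a, - (a + b + 2):] * f"
  have "((\<lambda>x. poly ?g x * jacobi_weight a b x) has_integral (?F 1 - ?F (-1))) {-1..1}"
  \<comment> \<open>The derivative may blow up at the endpoints, so it is required only inside, with
    continuity on the closed interval.\<close>
  proof (rule fundamental_theorem_of_calculus_interior)
    show "continuous_on {-1..1} ?F"
      using a b by (intro continuous_intros continuous_on_powr') auto
  next
    fix x :: real
    assume x: "x \<in> {-1<..<1}"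
    have e: "(1 - x) powr (a + 1) = (1 - x) * (1 - x) powr a"
      "(1 + x) powr (b + 1) = (1 + x) * (1 + x) powr b"
      using x by (simp_all add: powr_add)
    have d1: "((\<lambda>x. (1 - x) powr (a + 1)) has_real_derivative - ((a + 1) * (1 - x) powr a)) (at x)"
      using x by (auto intro!: derivative_eq_intros)
    have d2: "((\<lambda>x. (1 + x) powr (b + 1)) has_real_derivative (b + 1) * (1 + x) powr b) (at x)"
      using x by (auto intro!: derivative_eq_intros)
    have "(?F has_real_derivative
        (- ((a + 1) * (1 - x) powr a) * (1 + x) powr (b + 1)
          + (b + 1) * (1 + x) powr b * (1 - x) powr (a + 1)) * poly f x
        + poly (pderiv f) x * ((1 - x) powr (a + 1) * (1 + x) powr (b + 1))) (at x)"
      by (rule DERIV_mult[OF DERIV_mult[OF d1 d2] poly_DERIV])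
    also have "(- ((a + 1) * (1 - x) powr a) * (1 + x) powr (b + 1)
          + (b + 1) * (1 + x) powr b * (1 - x) powr (a + 1)) * poly f x
        + poly (pderiv f) x * ((1 - x) powr (a + 1) * (1 + x) powr (b + 1))
        = poly ?g x * jacobi_weight a b x"
      unfolding e jacobi_weight_def by (simp add: algebra_simps)
    finally show "(?F has_vector_derivative poly ?g x * jacobi_weight a b x) (at x)"
      by (simp add: has_real_derivative_iff_has_vector_derivative)
  qed simp
  then show ?thesis
    using a b unfolding jacobi_integral_def by (simp add: integral_unique)
qed

text \<open>Integration by parts, with f = p' q as the total derivative, turns either side into
  minus the integral of (1 - x^2) p' q' w, which is symmetric in p and q.\<close>

lemma jacobi_operator_symmetric:
  "jacobi_integral a b (jacobi_operator a b p * q) = jacobi_integral a b (p * jacobi_operator a b q)"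
proof -
  have *: "jacobi_integral a b (jacobi_operator a b p * q)
      = - jacobi_integral a b ([:1, 0, -1:] * (pderiv p * pderiv q))" for p q
  proof -
    have "[:1, 0, -1:] * pderiv (pderiv p * q) + [:b - a, - (a + b + 2):] * (pderiv p * q)
        = jacobi_operator a b p * q + [:1, 0, -1:] * (pderiv p * pderiv q)"
      unfolding jacobi_operator_def pderiv_mult by (simp only: algebra_simps)
    then show ?thesis
      using jacobi_integral_total_derivative[of "pderiv p * q"] jacobi_integral_add
      by simp
  qed
  show ?thesis
    using *[of p q] *[of q p] by (simp only: mult.commute)
qed

lemma jacobi_integral_square_eq_0:
  assumes "jacobi_integral a b (p * p) = 0"
  shows "p = 0"
proof -
  let ?f = "\<lambda>x. poly (p * p) x * jacobi_weight a b x"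
  have nonneg: "?f x \<ge> 0" for x
    by (simp add: jacobi_weight_nonneg)
  \<comment> \<open>Away from the endpoints the weight is continuous and strictly positive;
    infinitely many zeros there suffice.\<close>
  have cont: "continuous_on {-1/2..1/2} ?f"
    unfolding jacobi_weight_def by (intro continuous_intros) auto
  have "integral {-1/2..1/2} ?f \<le> integral {-1..1} ?f"
    using nonneg
    by (intro integral_subset_le poly_jacobi_weight_integrable a b integrable_continuous_real cont)
       auto
  moreover have "integral {-1/2..1/2} ?f \<ge> 0"
    by (intro integral_nonneg integrable_continuous_real cont nonneg)
  ultimately have "integral {-1/2..1/2} ?f = 0"
    using assms by (simp add: jacobi_integral_def)
  then have "\<forall>x\<in>{-1/2..1/2}. ?f x = 0"
    using integral_eq_0_iff[OF cont] nonneg by auto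
  then have "{-1/2..1/2} \<subseteq> {x. poly p x = 0}"
    by (auto simp: jacobi_weight_def)
  moreover have "infinite {-1/2..1/2::real}"
    by (rule infinite_Icc) simp
  ultimately have "infinite {x. poly p x = 0}"
    using finite_subset by blast
  then show "p = 0"
    using poly_roots_finite by blast
qed

end

section \<open>The operator in powers of x - 1\<close>

text \<open>With t = x - 1 the coefficients are -2t - t^2 and -2(a + 1) - (a + b + 2) t. As the
  first vanishes at t = 0, the operator sends t^n to a combination of t^n and t^(n-1) only.\<close>

lemma coeff_jacobi_operator_at_1:
  "coeff (pcompose (jacobi_operator a b p) [:1, 1:]) n =
     - (real n * (real n + a + b + 1)) * coeff (pcompose p [:1, 1:]) n
     - 2 * (real n + 1) * (real n + a + 1) * coeff (pcompose p [:1, 1:]) (Suc n)"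
proof -
  let ?r = "pcompose p [:1, 1:]"
  have d: "pderiv (pcompose q [:1, 1:]) = pcompose (pderiv q) [:1, 1:]" for q :: "real poly"
    by (simp add: pderiv_pcompose pderiv_pCons)
  have shifted: "pcompose [:1, 0, -1:] [:1, 1:] = [:0, -2, -1 :: real:]"
    "pcompose [:b - a, - (a + b + 2):] [:1, 1:] = [:-2 * (a + 1), - (a + b + 2):]"
    by (simp_all add: pcompose_pCons)
  have "pcompose (jacobi_operator a b p) [:1, 1:]
      = [:0, -2, -1:] * pderiv (pderiv ?r) + [:-2 * (a + 1), - (a + b + 2):] * pderiv ?r"
    by (simp only: jacobi_operator_def d pcompose_add pcompose_mult shifted)
  then show ?thesis
    by (auto simp: coeff_pCons coeff_pderiv algebra_simps split: nat.splits)
qed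

text \<open>Translation preserves degree. Vanishing of all coefficients from \<open>k\<close> on
  expresses degree below \<open>k\<close> so that the zero polynomial and \<open>k = 0\<close> are
  covered too.\<close>

lemma pcompose_shift_low_degree_iff:
  fixes q :: "real poly"
  shows "(\<forall>n\<ge>k. coeff (pcompose q [:1, 1:]) n = 0) \<longleftrightarrow> (\<forall>n\<ge>k. coeff q n = 0)"
proof -
  have *: "(\<forall>n\<ge>k. coeff q n = 0) \<longleftrightarrow> q = 0 \<or> degree q < k" for q :: "real poly"
    by (metis coeff_0 coeff_eq_0 le_degree leading_coeff_0_iff linorder_not_le order_less_le_trans)
  show ?thesis
    unfolding * by (simp add: degree_pcompose pcompose_eq_0_iff)
qed

lemma jacobi_operator_low_degree:
  assumes "\<forall>n\<ge>k. coeff q n = 0"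
  shows "\<forall>n\<ge>k. coeff (jacobi_operator a b q) n = 0"
  using assms
  by (subst pcompose_shift_low_degree_iff[symmetric],
      subst (asm) pcompose_shift_low_degree_iff[symmetric]) (simp add: coeff_jacobi_operator_at_1)

section \<open>Jacobi polynomials: eigenvalue equation and Taylor coefficients at 1\<close>

context
  fixes a b :: real and P :: "nat \<Rightarrow> real poly"
  assumes a: "a > -1" and b: "b > -1" and P: "jacobi_polynomials a b P"
begin

lemma jacobi_polynomial_degree: "degree (P k) = k" and jacobi_polynomial_nonzero: "P k \<noteq> 0"
  using P by (auto simp: jacobi_polynomials_def)

lemma jacobi_orthogonal: "j \<noteq> k \<Longrightarrow> jacobi_integral a b (P j * P k) = 0"
  using P by (simp add: jacobi_polynomials_def jacobi_integral_def jacobi_weight_def)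

text \<open>The P m with m < k span the polynomials of degree below k. The degree bound
  \<open>m\<close> is separated from \<open>k\<close> so that subtracting a multiple of
  \<open>P m\<close> can lower it.\<close>

lemma jacobi_orthogonal_low_degree:
  assumes "\<forall>n\<ge>k. coeff q n = 0"
  shows "jacobi_integral a b (P k * q) = 0"
proof -
  have "jacobi_integral a b (P k * q) = 0" if "m \<le> k" "\<forall>n\<ge>m. coeff q n = 0" for m q
    using that
  proof (induction m arbitrary: q)
    case 0
    then have "q = 0"
      by (simp add: poly_eq_iff)
    then show ?case
      by (simp add: jacobi_integral_def)
  next
    case (Suc m)
    have lead: "coeff (P m) m \<noteq> 0"
      using jacobi_polynomial_degree[of m] jacobi_polynomial_nonzero[of m]
      by (metis leading_coeff_0_iff)
    define c where "c = coeff q m / coeff (P m) m"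
    have "coeff (q - Polynomial.smult c (P m)) n = 0" if "n \<ge> m" for n
      using that Suc.prems(2) lead jacobi_polynomial_degree[of m]
      by (cases "n = m") (auto simp: c_def coeff_eq_0)
    then have "jacobi_integral a b (P k * (q - Polynomial.smult c (P m))) = 0"
      using Suc by auto
    moreover have "jacobi_integral a b (P k * P m) = 0"
      using Suc.prems(1) by (intro jacobi_orthogonal) auto
    ultimately show ?case
      by (simp add: right_diff_distrib jacobi_integral_diff jacobi_integral_smult a b)
  qed
  then show ?thesis
    using assms by blast
qed

text \<open>The eigenvalue is read off the top coefficient, so the defect \<open>R\<close> has
  degree below \<open>k\<close>. Moving the operator onto \<open>R\<close> leaves only pairings of
  \<open>P k\<close> with polynomials of lower degree; thus \<open>R\<close> is orthogonal to
  itself.\<close>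

lemma jacobi_eigenvector:
  "jacobi_operator a b (P k) = Polynomial.smult (- (real k * (real k + a + b + 1))) (P k)"
proof -
  define \<theta> where "\<theta> = - (real k * (real k + a + b + 1))"
  define R where "R = jacobi_operator a b (P k) - Polynomial.smult \<theta> (P k)"
  have "\<forall>n\<ge>k. coeff (pcompose R [:1, 1:]) n = 0"
  proof (intro allI impI)
    fix n
    assume "n \<ge> k"
    moreover have "coeff (pcompose (P k) [:1, 1:]) n = 0" if "n > k" for n
      using that jacobi_polynomial_degree[of k] by (simp add: coeff_eq_0 degree_pcompose)
    ultimately show "coeff (pcompose R [:1, 1:]) n = 0"
      by (cases "n = k")
         (auto simp: R_def \<theta>_def pcompose_diff pcompose_add pcompose_uminus pcompose_smult coeff_jacobi_operator_at_1)
  qed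
  then have low: "\<forall>n\<ge>k. coeff R n = 0"
    by (simp add: pcompose_shift_low_degree_iff)
  have "jacobi_integral a b (R * R) = jacobi_integral a b (jacobi_operator a b (P k) * R)
      - jacobi_integral a b (Polynomial.smult \<theta> (P k * R))"
    by (subst R_def) (simp add: left_diff_distrib jacobi_integral_diff a b)
  also have "\<dots> = 0"
    using jacobi_orthogonal_low_degree[OF low]
      jacobi_orthogonal_low_degree[OF jacobi_operator_low_degree[OF low, of a b]]
    by (simp only: jacobi_operator_symmetric jacobi_integral_smult a b)
  finally have "R = 0"
    by (rule jacobi_integral_square_eq_0[OF a b])
  then show ?thesis
    by (simp add: R_def \<theta>_def)
qed

lemma coeff_jacobi_polynomial_at_1:
  "coeff (pcompose (P k) [:1, 1:]) m =
     poly (P k) 1 * (factorial_power a b ((real k + eps a b)\<^sup>2) m / (2 ^ m * fact m * pochhammer (a + 1) m))"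
proof (induction m)
  case 0
  then show ?case
    by (simp add: factorial_power_def coeff_pcompose_0)
next
  case (Suc m)
  let ?r = "\<lambda>m. coeff (pcompose (P k) [:1, 1:]) m"
  have "- (real m * (real m + a + b + 1)) * ?r m - 2 * (real m + 1) * (real m + a + 1) * ?r (Suc m)
      = - (real k * (real k + a + b + 1)) * ?r m"
    by (subst coeff_jacobi_operator_at_1[symmetric])
       (simp add: jacobi_eigenvector pcompose_uminus pcompose_smult)
  \<comment> \<open>Completing the square turns the difference of eigenvalues into one factor of
    \<open>factorial_power\<close>.\<close>
  then have "2 * (real m + 1) * (real m + a + 1) * ?r (Suc m)
      = ((real k + eps a b)\<^sup>2 - (eps a b + real m)\<^sup>2) * ?r m"
    by (simp add: eps_def power2_eq_square field_simps)
  moreover have "2 * (real m + 1) * (real m + a + 1) \<noteq> 0"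
    using a by simp
  ultimately have "?r (Suc m) = ((real k + eps a b)\<^sup>2 - (eps a b + real m)\<^sup>2) * ?r m
      / (2 * (real m + 1) * (real m + a + 1))"
    by (metis nonzero_mult_div_cancel_left)
  then show ?case
    unfolding Suc.IH
    by (simp add: factorial_power_def pochhammer_Suc ac_simps)
qed

text \<open>Every Taylor coefficient at 1 is a multiple of this value.\<close>

lemma jacobi_polynomial_at_1_nonzero: "poly (P k) 1 \<noteq> 0"
proof
  assume "poly (P k) 1 = 0"
  then have "pcompose (P k) [:1, 1:] = 0"
    by (intro poly_eqI) (simp add: coeff_jacobi_polynomial_at_1)
  then show False
    using jacobi_polynomial_nonzero[of k] by (simp add: pcompose_eq_0_iff)
qed

end

section \<open>Expansion in Schur polynomials\<close>

text \<open>Cauchy-Binet for the coefficient matrix of the \<open>p i\<close> times the matrix of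
  powers of the variables; the minors of the latter are the Schur alternants.\<close>

lemma alternant_quotient_schur_expansion:
  fixes p :: "nat \<Rightarrow> real poly" and N :: nat and S :: "nat set"
  assumes S: "finite S" and supp: "\<And>i m. i < N \<Longrightarrow> m \<notin> S \<Longrightarrow> coeff (p i) m = 0"
  defines "G \<equiv> {\<mu> \<in> GTplus N. \<forall>i<N. shifted N \<mu> i \<in> S}"
  shows "alternant_quotient N p x =
    (\<Sum>\<mu>\<in>G. Determinant.det (Matrix.mat N N (\<lambda>(i, k). coeff (p i) (shifted N \<mu> k))) * schur N \<mu> x)"
proof -
  have "poly (p i) t = (\<Sum>m\<in>S. coeff (p i) m * t ^ m)" if "i < N" for i t
  proof -
    have "(\<Sum>m\<le>degree (p i). coeff (p i) m * t ^ m) = (\<Sum>m\<in>S \<union> {..degree (p i)}. coeff (p i) m * t ^ m)"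
      by (rule sum.mono_neutral_left) (auto simp: S coeff_eq_0)
    also have "\<dots> = (\<Sum>m\<in>S. coeff (p i) m * t ^ m)"
      by (rule sum.mono_neutral_right) (auto simp: S supp that)
    finally show ?thesis
      by (simp add: poly_altdef)
  qed
  then have "Matrix.mat N N (\<lambda>(i, j). poly (p i) (y j))
      = Matrix.mat N N (\<lambda>(i, j). \<Sum>m\<in>S. coeff (p i) m * y j ^ m)" for y
    by (intro cong_mat) auto
  moreover have "schur N \<mu> y * vandermonde N y
      = Determinant.det (Matrix.mat N N (\<lambda>(k, j). y j ^ shifted N \<mu> k))" for \<mu> y
    by (simp add: schur_def alternant_quotient_times_vandermonde poly_monom)
  ultimately have "(\<Sum>\<mu>\<in>G. Determinant.det (Matrix.mat N N (\<lambda>(i, k). coeff (p i) (shifted N \<mu> k)))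
        * schur N \<mu> y) * vandermonde N y
      = Determinant.det (Matrix.mat N N (\<lambda>(i, j). poly (p i) (y j)))" for y
    unfolding G_def by (simp add: cauchy_binet_GTplus S sum_distrib_right mult.assoc)
  then have "alternant_quotient N p = (\<lambda>x. \<Sum>\<mu>\<in>G.
      Determinant.det (Matrix.mat N N (\<lambda>(i, k). coeff (p i) (shifted N \<mu> k))) * schur N \<mu> x)"
    by (intro alternant_quotient_eqI)
       (auto simp: schur_def intro!: polynomial_in_sum polynomial_in.mult polynomial_in.const
          polynomial_in_alternant_quotient)
  then show ?thesis
    by simp
qed

section \<open>Vanishing, nondegeneracy and constants\<close>

lemma finite_GTplus_bounded: "finite {\<mu> \<in> GTplus N. \<forall>i<N. shifted N \<mu> i \<le> M}"
proof (rule finite_subset)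
  show "{\<mu> \<in> GTplus N. \<forall>i<N. shifted N \<mu> i \<le> M} \<subseteq> {\<mu>. set \<mu> \<subseteq> {..M} \<and> length \<mu> = N}"
    by (force simp: GTplus_def shifted_def in_set_conv_nth)
qed (rule finite_lists_length_eq, simp)

lemma factorial_power_eq_0: "k < m \<Longrightarrow> factorial_power a b ((real k + eps a b)\<^sup>2) m = 0"
  unfolding factorial_power_def by (intro prod_zero bexI[of _ k]) (auto simp: add.commute)

lemma tstar_eq_0:
  assumes "k < N" "\<And>i. i < N \<Longrightarrow> shifted N \<Lambda> i < shifted N \<mu> k"
  shows "tstar a b N \<mu> \<Lambda> = 0"
proof -
  let ?f = "\<lambda>i j. factorial_power a b (lhat a b N \<Lambda> i) (shifted N \<mu> j)"
  \<comment> \<open>Column \<open>k\<close> is zero, expressed as scaling that column by 0.\<close>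
  let ?d = "\<lambda>j. if j = k then 0 else 1 :: real"
  have "Matrix.mat N N (\<lambda>(i, j). ?f i j) = Matrix.mat N N (\<lambda>(i, j). 1 * ?f i j * ?d j)"
    using assms by (intro cong_mat) (auto simp: lhat_def factorial_power_eq_0)
  moreover have "(\<Prod>j<N. ?d j) = 0"
    using assms(1) by (intro prod_zero) auto
  ultimately show ?thesis
    using det_scale_rows_columns[of N "\<lambda>_. 1" ?f ?d] by (simp add: tstar_def)
qed

lemma vandermonde_lhat_nonzero:
  assumes "a > -1" "b > -1" "\<Lambda> \<in> GTplus N"
  shows "vandermonde N (lhat a b N \<Lambda>) \<noteq> 0"
proof
  assume "vandermonde N (lhat a b N \<Lambda>) = 0"
  then obtain i j where ij: "j < N" "i < j" "lhat a b N \<Lambda> i = lhat a b N \<Lambda> j"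
    by (auto simp: vandermonde_eq_0_iff)
  have "shifted N \<Lambda> j < shifted N \<Lambda> i"
    using assms(3) ij by (intro shifted_strict_antimono)
  \<comment> \<open>Equal squares with distinct l_i, l_j would force l_i + l_j + a + b + 1 = 0; l_i
    >= 1 and a + b + 1 > -1 make this sum positive.\<close>
  moreover from this have "real (shifted N \<Lambda> i) \<ge> 1"
    by linarith
  ultimately show False
    using ij(3) assms(1,2) unfolding lhat_def eps_def power2_eq_iff by (auto simp: field_simps)
qed

text \<open>Generalized powers are monic of degree equal to their exponent. This is the numerator of
  \<open>tstar\<close> for the empty partition, so that \<open>tstar\<close> itself is 1 there when
  the nodes are distinct.\<close>

lemma det_factorial_power_staircase:
  "Determinant.det (Matrix.mat N N (\<lambda>(i, k). factorial_power a b (x i) (N - Suc k))) = vandermonde N x"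
proof -
  define F where "F m = (\<Prod>i<m. [:- (eps a b + real i)\<^sup>2, 1:])" for m
  have F: "degree (F m) = m" for m
    unfolding F_def by (simp add: degree_prod_eq_sum_degree)
  have monic: "lead_coeff (F m) = 1" for m
    unfolding F_def lead_coeff_prod by simp
  have "Matrix.mat N N (\<lambda>(i, k). factorial_power a b (x i) (N - Suc k))
      = transpose_mat (Matrix.mat N N (\<lambda>(k, i). poly (F (N - Suc k)) (x i)))"
    by (rule eq_matI) (auto simp: F_def factorial_power_def poly_prod)
  then show ?thesis
    using F monic by (simp add: det_transpose[of _ N] alternant_monic_eq_vandermonde)
qed

definition jacobi_denominator :: "real \<Rightarrow> nat \<Rightarrow> real" where
  "jacobi_denominator a m = 2 ^ m * fact m * pochhammer (a + 1) m"

lemma jacobi_denominator_nonzero: "a > -1 \<Longrightarrow> jacobi_denominator a m \<noteq> 0"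
  using pochhammer_pos[of "a + 1" m] by (simp add: jacobi_denominator_def)

text \<open>The origin of c(N, mu): m! = (1)_m, and (z)_(n+m) = (z)_n (z+n)_m splits off the
  staircase part n = N - Suc k, leaving symbols based at N - k and N - k + a.\<close>

lemma prod_jacobi_denominator_shifted:
  assumes "\<mu> \<in> GTplus N"
  shows "(\<Prod>k<N. jacobi_denominator a (shifted N \<mu> k))
    = (\<Prod>k<N. jacobi_denominator a (N - Suc k)) * (2 ^ sum_list \<mu> * cfactor a N \<mu>)"
proof -
  have "jacobi_denominator a (shifted N \<mu> k) = jacobi_denominator a (N - Suc k) *
      (2 ^ (\<mu> ! k) * (pochhammer (real (N - k)) (\<mu> ! k) * pochhammer (real (N - k) + a) (\<mu> ! k)))"
    if "k < N" for k
  proof -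
    have "shifted N \<mu> k = (N - Suc k) + \<mu> ! k" "real (N - k) = 1 + real (N - Suc k)"
      using that by (simp_all add: shifted_def)
    then show ?thesis
      by (simp only: jacobi_denominator_def pochhammer_product' pochhammer_fact power_add)
         (simp only: of_nat_id ac_simps)
  qed
  moreover have "(2::real) ^ sum_list \<mu> = (\<Prod>k<N. 2 ^ (\<mu> ! k))"
    using assms by (simp add: GTplus_def sum_list_sum_nth power_sum atLeast0LessThan)
  ultimately show ?thesis
    by (simp add: cfactor_def prod.distrib)
qed

theorem propositionB1:
  fixes a b :: real and N :: nat and \<Lambda> :: "nat list" and P :: "nat \<Rightarrow> real poly"
  assumes "a > -1" and "b > -1" and "N \<ge> 1"
    and "jacobi_polynomials a b P"
    and "\<Lambda> \<in> GTplus N"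
  shows "finite {\<mu> \<in> GTplus N. tstar a b N \<mu> \<Lambda> \<noteq> 0} \<and>
    (\<forall>x :: nat \<Rightarrow> real.
       normalized_jacobi P N \<Lambda> (\<lambda>i. 1 + x i) =
       (\<Sum>\<^sub>\<infinity>\<mu>\<in>GTplus N. tstar a b N \<mu> \<Lambda> * schur N \<mu> x
                    / (2 ^ sum_list \<mu> * cfactor a N \<mu>)))"
proof (intro conjI allI)
  define M where "M = shifted N \<Lambda> 0"
  define G where "G = {\<mu> \<in> GTplus N. \<forall>i<N. shifted N \<mu> i \<le> M}"
  have M: "shifted N \<Lambda> i \<le> M" if "i < N" for i
    using shifted_strict_antimono[OF assms(5), of 0 i] that by (cases "i = 0") (auto simp: M_def)
  have "finite G"
    unfolding G_def by (rule finite_GTplus_bounded)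
  \<comment> \<open>Some exponent of \<mu> exceeds every l_i, so its whole column of generalized
    powers vanishes.\<close>
  have tstar0: "tstar a b N \<mu> \<Lambda> = 0" if "\<mu> \<in> GTplus N - G" for \<mu>
    using that M by (force simp: G_def intro: tstar_eq_0)
  then show "finite {\<mu> \<in> GTplus N. tstar a b N \<mu> \<Lambda> \<noteq> 0}"
    by (intro finite_subset[OF _ \<open>finite G\<close>]) auto

  fix x :: "nat \<Rightarrow> real"
  define p where "p i = pcompose (P (shifted N \<Lambda> i)) [:1, 1:]" for i
  define F where "F i m = factorial_power a b (lhat a b N \<Lambda> i) m" for i m
  define C where "C = (\<Prod>i<N. poly (P (shifted N \<Lambda> i)) 1)"
  define W where "W f = (\<Prod>k<N. jacobi_denominator a (f k))" for f :: "nat \<Rightarrow> nat"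
  define V where "V = vandermonde N (lhat a b N \<Lambda>)"
  have nz: "V \<noteq> 0" "C \<noteq> 0" "W f \<noteq> 0" for f
    using vandermonde_lhat_nonzero[of a b] jacobi_polynomial_at_1_nonzero[of a b P] assms
    by (simp_all add: V_def C_def W_def jacobi_denominator_nonzero)
  have coeff_p: "coeff (p i) m = poly (P (shifted N \<Lambda> i)) 1 * F i m * inverse (jacobi_denominator a m)"
    for i m
    using coeff_jacobi_polynomial_at_1[OF assms(1,2,4)]
    by (simp add: p_def F_def lhat_def jacobi_denominator_def divide_inverse)
  \<comment> \<open>Values at 1 come out of the rows and denominators out of the columns. Arbitrary
    \<open>f\<close> allows both the staircase and every shifted partition.\<close>
  have det_coeff: "Determinant.det (Matrix.mat N N (\<lambda>(i, k). coeff (p i) (f k)))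
      = C / W f * Determinant.det (Matrix.mat N N (\<lambda>(i, k). F i (f k)))" for f
    unfolding coeff_p det_scale_rows_columns
    by (simp add: C_def W_def prod_inversef[unfolded o_def] divide_inverse)
  have shift: "multi_jacobi P N \<Lambda> (\<lambda>i. 1 + y i) = alternant_quotient N p y" for y
    unfolding multi_jacobi_def p_def by (rule alternant_quotient_shift)
  have "multi_jacobi P N \<Lambda> (\<lambda>_. 1) = C / W (\<lambda>k. N - Suc k) * V"
    using shift[of "\<lambda>_. 0"]
    by (simp add: alternant_quotient_at_0 det_coeff[of "\<lambda>k. N - Suc k"])
       (simp add: F_def V_def det_factorial_power_staircase)
  moreover have "multi_jacobi P N \<Lambda> (\<lambda>i. 1 + x i)
      = (\<Sum>\<mu>\<in>G. C / W (shifted N \<mu>) * (tstar a b N \<mu> \<Lambda> * V) * schur N \<mu> x)"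
  proof -
    have "coeff (p i) m = 0" if "i < N" "m \<notin> {..M}" for i m
      using that M[of i] unfolding coeff_p by (simp add: F_def lhat_def factorial_power_eq_0)
    from alternant_quotient_schur_expansion[OF finite_atMost this]
    have "alternant_quotient N p x = (\<Sum>\<mu>\<in>G.
        Determinant.det (Matrix.mat N N (\<lambda>(i, k). coeff (p i) (shifted N \<mu> k))) * schur N \<mu> x)"
      by (simp add: G_def)
    then show ?thesis
      unfolding det_coeff shift using nz(1) by (simp add: tstar_def V_def F_def)
  qed
  moreover have "W (shifted N \<mu>) = W (\<lambda>k. N - Suc k) * (2 ^ sum_list \<mu> * cfactor a N \<mu>)"
    if "\<mu> \<in> G" for \<mu>
    using that unfolding W_def G_def by (intro prod_jacobi_denominator_shifted) simp
  ultimately have "normalized_jacobi P N \<Lambda> (\<lambda>i. 1 + x i)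
      = (\<Sum>\<mu>\<in>G. tstar a b N \<mu> \<Lambda> * schur N \<mu> x / (2 ^ sum_list \<mu> * cfactor a N \<mu>))"
    using nz by (simp add: normalized_jacobi_def sum_divide_distrib sum_distrib_right)
  also have "\<dots> = (\<Sum>\<^sub>\<infinity>\<mu>\<in>G. tstar a b N \<mu> \<Lambda> * schur N \<mu> x / (2 ^ sum_list \<mu> * cfactor a N \<mu>))"
    using \<open>finite G\<close> by simp
  also have "\<dots> = (\<Sum>\<^sub>\<infinity>\<mu>\<in>GTplus N. tstar a b N \<mu> \<Lambda> * schur N \<mu> x / (2 ^ sum_list \<mu> * cfactor a N \<mu>))"
    by (rule infsum_cong_neutral) (auto simp: tstar0, auto simp: G_def)
  finally show "normalized_jacobi P N \<Lambda> (\<lambda>i. 1 + x i)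
      = (\<Sum>\<^sub>\<infinity>\<mu>\<in>GTplus N. tstar a b N \<mu> \<Lambda> * schur N \<mu> x / (2 ^ sum_list \<mu> * cfactor a N \<mu>))" .
qed

end
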